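(* Let $p,g_i,S,d,R,\eta_i,\beta,f_\gamma,N,D,p^*$ be as in the context. For each positive integer $r$ let $$l_r=\sup\Big\{\gamma\in\mathbb{R} : \exists\text{ a nonzero sos form } q \text{ of degree } 2r \text{ in } z \text{ such that } \Big(f_\gamma(z)-\tfrac{1}{r}\big(\textstyle\sum_{i=1}^N z_i^2\big)^D\Big)\cdot q(z)\text{ is sos}\Big\}$$ (with $\sup\emptyset=-\infty$), i.e., $f_\gamma-\frac1r(\sum_i z_i^2)^D\in A^r_{N,2D}$. Then $l_r\le p^*$ for all $r$, $\{l_r\}$ is nondecreasing, and $\lim_{r\to\infty}l_r=p^*$.
   Context: Let $p,g_1,\dots,g_m$ be real polynomials in $x=(x_1,\dots,x_n)$ and let $S=\{x\in\mathbb{R}^n : g_i(x)\ge 0,\ i=1,\dots,m\}$. Let $p^*=\inf_{x\in S}p(x)$ (with $p^*=+\infty$ if $S=\emptyset$). Let $d\ge 1$ be the integer such that $2d$ is the smallest even integer larger than or equal to the maximum of the degrees of $p,g_1,\dots,g_m$. Assume there is $R>0$ with $\sum_{i=1}^n x_i^2\le R$ for all $x\in S$. Let $\eta_1,\dots,\eta_m$ be real numbers with $g_i(x)\le\eta_i$ for all $x\in S$, and let $\beta$ be a real number with $-p(x)\le\beta$ for all $x\in S$. For a polynomial $q$ in $x$ of degree at most $2d$, $y^{2d}q(x/y)$ denotes its homogenization to a form of degree $2d$ in $(x,y)$. For $\gamma\in\mathbb{R}$ define the form in the variables $z=(x,s,y)=(x_1,\dots,x_n,s_0,\dots,s_{m+1},y)$: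 $$f_\gamma(x,s,y)=\big(\gamma y^{2d}-y^{2d}p(x/y)-s_0^2y^{2d-2}\big)^2+\sum_{i=1}^m\big(y^{2d}g_i(x/y)-s_i^2y^{2d-2}\big)^2+\Big(\big(R+\textstyle\sum_{i=1}^m\eta_i+\beta+\gamma\big)^d y^{2d}-\big(\sum_{i=1}^n x_i^2+\sum_{i=0}^m s_i^2\big)^d-s_{m+1}^{2d}\Big)^2.$$ Set $N=n+m+3$ and $D=2d$, so $f_\gamma$ is a form of degree $2D$ in $N$ variables. A polynomial is a sum of squares (sos) if it is a finite sum of squares of real polynomials. The Artin cone of level $r$ is $A^r_{n',2d'}=\{q \text{ form of degree } 2d' \text{ in } n' \text{ variables} : q\cdot h \text{ is sos for some nonzero sos form } h \text{ of degree } 2r\}$. *)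

theory Defs
  imports Complex_Main "HOL-Library.Poly_Mapping" "HOL-Library.Extended_Real"
begin

text \<open>Real multivariate polynomials, represented by their coefficients:
  a monomial is an exponent vector \<open>nat \<Rightarrow>\<^sub>0 nat\<close> (variable i has exponent
  lookup alpha i), and a polynomial is a finitely supported map from monomials to
  real coefficients.  Ring operations are those of the poly_mapping library
  (multiplication is convolution).\<close>

type_synonym mpoly = "(nat \<Rightarrow>\<^sub>0 nat) \<Rightarrow>\<^sub>0 real"

definition mon_deg :: "(nat \<Rightarrow>\<^sub>0 nat) \<Rightarrow> nat" where
  "mon_deg a = (\<Sum>i\<in>Poly_Mapping.keys a. Poly_Mapping.lookup a i)"

definition PVar :: "nat \<Rightarrow> mpoly" where
  "PVar i = Poly_Mapping.single (Poly_Mapping.single i 1) 1"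

definition PConst :: "real \<Rightarrow> mpoly" where
  "PConst c = Poly_Mapping.single 0 c"

definition vars_in :: "nat \<Rightarrow> mpoly \<Rightarrow> bool" where
  "vars_in k q \<longleftrightarrow> (\<forall>a\<in>Poly_Mapping.keys q. \<forall>i\<in>Poly_Mapping.keys a. i < k)"

definition deg_le :: "nat \<Rightarrow> mpoly \<Rightarrow> bool" where
  "deg_le k q \<longleftrightarrow> (\<forall>a\<in>Poly_Mapping.keys q. mon_deg a \<le> k)"

definition is_form :: "nat \<Rightarrow> mpoly \<Rightarrow> bool" where
  "is_form k q \<longleftrightarrow> (\<forall>a\<in>Poly_Mapping.keys q. mon_deg a = k)"

definition peval :: "mpoly \<Rightarrow> (nat \<Rightarrow> real) \<Rightarrow> real" where
  "peval q v = (\<Sum>a\<in>Poly_Mapping.keys q. Poly_Mapping.lookup q a *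
      (\<Prod>i\<in>Poly_Mapping.keys a. v i ^ Poly_Mapping.lookup a i))"

definition sos_in :: "nat \<Rightarrow> mpoly \<Rightarrow> bool" where
  "sos_in k q \<longleftrightarrow> (\<exists>hs. (\<forall>h\<in>set hs. vars_in k h) \<and> q = sum_list (map (\<lambda>h. h * h) hs))"

definition artin_cone :: "nat \<Rightarrow> nat \<Rightarrow> nat \<Rightarrow> mpoly set" where
  "artin_cone n' d' r = {q. vars_in n' q \<and> is_form (2*d') q \<and>
     (\<exists>h. h \<noteq> 0 \<and> vars_in n' h \<and> is_form (2*r) h \<and> sos_in n' h \<and> sos_in n' (q * h))}"

definition homog :: "nat \<Rightarrow> nat \<Rightarrow> mpoly \<Rightarrow> mpoly" where
  "homog yi k q = (\<Sum>a\<in>Poly_Mapping.keys q.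
      Poly_Mapping.single (a + Poly_Mapping.single yi (k - mon_deg a)) (Poly_Mapping.lookup q a))"

text \<open>Variables: x_1..x_n have indices 0..n-1, s_j (j = 0..m+1) has index n+j,
  y has index n+m+2.  The constraints g_1..g_m are g 0 .. g (m-1), with bounds
  eta 0 .. eta (m-1); g (i) is paired with s_(i+1).\<close>
definition f_gamma :: "nat \<Rightarrow> nat \<Rightarrow> nat \<Rightarrow> real \<Rightarrow> (nat \<Rightarrow> real) \<Rightarrow> real \<Rightarrow>
    mpoly \<Rightarrow> (nat \<Rightarrow> mpoly) \<Rightarrow> real \<Rightarrow> mpoly" where
  "f_gamma n m d R eta \<beta> p g \<gamma> =
    (let Y = PVar (n+m+2); s = (\<lambda>j. PVar (n+j)); hom = homog (n+m+2) (2*d) in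
      (PConst \<gamma> * Y^(2*d) - hom p - s 0 ^ 2 * Y^(2*d-2))^2
    + (\<Sum>i<m. (hom (g i) - s (i+1) ^ 2 * Y^(2*d-2))^2)
    + (PConst ((R + (\<Sum>i<m. eta i) + \<beta> + \<gamma>) ^ d) * Y^(2*d)
        - ((\<Sum>i<n. PVar i ^ 2) + (\<Sum>j\<le>m. s j ^ 2))^d - s (m+1) ^ (2*d))^2)"

text \<open>l_r, with sup of the empty set = -infinity\<close>
definition l_seq :: "nat \<Rightarrow> nat \<Rightarrow> nat \<Rightarrow> real \<Rightarrow> (nat \<Rightarrow> real) \<Rightarrow> real \<Rightarrow>
    mpoly \<Rightarrow> (nat \<Rightarrow> mpoly) \<Rightarrow> nat \<Rightarrow> ereal" where
  "l_seq n m d R eta \<beta> p g r =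
    (let N = n+m+3; D = 2*d in
     Sup {ereal \<gamma> | \<gamma>. f_gamma n m d R eta \<beta> p g \<gamma>
            - PConst (1 / real r) * (\<Sum>i<N. PVar i ^ 2)^D \<in> artin_cone N D r})"

text \<open>Feasible set S (points of R^n, as functions vanishing beyond n) and p^*
  (inf over the empty set = +infinity)\<close>
definition feas :: "nat \<Rightarrow> nat \<Rightarrow> (nat \<Rightarrow> mpoly) \<Rightarrow> (nat \<Rightarrow> real) set" where
  "feas n m g = {x. (\<forall>i\<ge>n. x i = 0) \<and> (\<forall>i<m. peval (g i) x \<ge> 0)}"

definition pstar :: "nat \<Rightarrow> nat \<Rightarrow> mpoly \<Rightarrow> (nat \<Rightarrow> mpoly) \<Rightarrow> ereal" where
  "pstar n m p g = (INF x\<in>feas n m g. ereal (peval p x))"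

end

theory Submission
  imports Defs "HOL-Analysis.Analysis"
begin

text \<open>If \<open>\<gamma>\<close> exceeds \<open>p x\<close> at a feasible point \<open>x\<close>, then slack values \<open>s\<close> make \<open>(x, s, 1)\<close> a zero of \<open>f\<^sub>\<gamma>\<close>,
  whereas forms in the Artin cone are nonnegative, so \<open>f\<^sub>\<gamma>\<close> minus a positive multiple of
  \<open>(\<Sum>z\<^sub>i\<^sup>2) ^ D\<close> is not in it.
  If \<open>\<gamma> < p\<^sup>*\<close>, then \<open>f\<^sub>\<gamma>\<close> is positive definite: a zero with \<open>y \<noteq> 0\<close> rescales to a feasible point, and
  for \<open>y = 0\<close> the last bracket forces all variables to vanish. By compactness it remains positive definite
  after subtracting a small multiple of \<open>(\<Sum>z\<^sub>i\<^sup>2) ^ D\<close>, and Habicht's theorem provides a sum of squares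
  denominator. Habicht's theorem reduces to forms in the squares of the variables by averaging over sign changes,
  and for these it is Polya's theorem.\<close>

section \<open>Monomials, degrees and evaluation of polynomials\<close>

abbreviation keys where "keys \<equiv> Poly_Mapping.keys"
abbreviation lookup where "lookup \<equiv> Poly_Mapping.lookup"
abbreviation single where "single \<equiv> Poly_Mapping.single"

lemma poly_mapping_expansion: "q = (\<Sum>a\<in>keys q. single a (lookup q a))"
proof (rule poly_mapping_eqI)
  fix b
  have "(\<Sum>a\<in>keys q. if a = b then lookup q a else 0) = lookup q b"
    by (simp add: in_keys_iff)
  then show "lookup q b = lookup (\<Sum>a\<in>keys q. single a (lookup q a)) b"
    by (simp add: lookup_sum lookup_single when_def)
qed

lemma keys_add_nat: "keys (a + b :: 'a \<Rightarrow>\<^sub>0 nat) = keys a \<union> keys b"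
  by (auto simp: in_keys_iff lookup_add)

definition monom_eval :: "(nat \<Rightarrow> real) \<Rightarrow> (nat \<Rightarrow>\<^sub>0 nat) \<Rightarrow> real" where
  "monom_eval v a = (\<Prod>i\<in>keys a. v i ^ lookup a i)"

text \<open>Enlarging the index set only adds factors \<open>v i ^ 0 = 1\<close>, so monomials with
  different supports can be treated over a common one.\<close>

lemma monom_eval_superset:
  assumes "finite I" "keys a \<subseteq> I"
  shows "monom_eval v a = (\<Prod>i\<in>I. v i ^ lookup a i)"
  unfolding monom_eval_def by (rule prod.mono_neutral_left) (use assms in \<open>auto simp: in_keys_iff\<close>)

lemma monom_eval_add: "monom_eval v (a + b) = monom_eval v a * monom_eval v b"
proof -
  let ?I = "keys a \<union> keys b"
  have "monom_eval v (a + b) = (\<Prod>i\<in>?I. v i ^ lookup (a + b) i)"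
    by (rule monom_eval_superset) (auto simp: keys_add_nat)
  then show ?thesis
    by (simp add: monom_eval_superset[of ?I a] monom_eval_superset[of ?I b] lookup_add power_add prod.distrib)
qed

lemma mon_deg_superset:
  assumes "finite I" "keys a \<subseteq> I"
  shows "mon_deg a = (\<Sum>i\<in>I. lookup a i)"
  unfolding mon_deg_def by (rule sum.mono_neutral_left) (use assms in \<open>auto simp: in_keys_iff\<close>)

lemma mon_deg_add: "mon_deg (a + b) = mon_deg a + mon_deg b"
proof -
  let ?I = "keys a \<union> keys b"
  have "mon_deg (a + b) = (\<Sum>i\<in>?I. lookup (a + b) i)"
    by (rule mon_deg_superset) (auto simp: keys_add_nat)
  then show ?thesis
    by (simp add: mon_deg_superset[of ?I a] mon_deg_superset[of ?I b] lookup_add sum.distrib)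
qed

lemma mon_deg_zero [simp]: "mon_deg 0 = 0"
  and mon_deg_single [simp]: "mon_deg (single i k) = k"
  by (auto simp: mon_deg_def)

lemma monom_eval_scale: "monom_eval (\<lambda>i. c * v i) a = c ^ mon_deg a * monom_eval v a"
  by (simp add: monom_eval_def mon_deg_def power_mult_distrib prod.distrib power_sum)

lemma peval_superset:
  assumes "finite K" "keys q \<subseteq> K"
  shows "peval q v = (\<Sum>a\<in>K. lookup q a * monom_eval v a)"
  unfolding peval_def monom_eval_def
  by (rule sum.mono_neutral_left) (use assms in \<open>auto simp: in_keys_iff\<close>)

lemma peval_eq: "peval q v = (\<Sum>a\<in>keys q. lookup q a * monom_eval v a)"
  by (rule peval_superset) auto

lemma peval_zero [simp]: "peval 0 v = 0"
  by (simp add: peval_def)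

lemma peval_single: "peval (single a c) v = c * monom_eval v a"
  by (simp add: peval_superset[of "{a}"])

lemma peval_add [simp]: "peval (p + q) v = peval p v + peval q v"
proof -
  let ?K = "keys p \<union> keys q"
  have "peval (p + q) v = (\<Sum>a\<in>?K. lookup (p + q) a * monom_eval v a)"
    by (rule peval_superset) (use keys_add[of p q] in auto)
  then show ?thesis
    by (simp add: peval_superset[of ?K p] peval_superset[of ?K q] lookup_add sum.distrib algebra_simps)
qed

lemma peval_sum [simp]: "peval (\<Sum>i\<in>I. f i) v = (\<Sum>i\<in>I. peval (f i) v)"
  by (induction I rule: infinite_finite_induct) auto

lemma peval_uminus [simp]: "peval (- p) v = - peval p v"
  using peval_add[of p "- p" v] by simp

lemma peval_diff [simp]: "peval (p - q) v = peval p v - peval q v"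
  using peval_add[of p "- q" v] by simp

text \<open>Reduces convolution to products of single monomials, on which evaluation and sign
  changes are checked term by term.\<close>

lemma times_expansion:
  fixes p q :: mpoly
  shows "p * q = (\<Sum>a\<in>keys p. \<Sum>b\<in>keys q. single (a + b) (lookup p a * lookup q b))"
  by (subst poly_mapping_expansion[of p], subst poly_mapping_expansion[of q])
    (simp only: sum_product mult_single)

lemma peval_mult [simp]: "peval (p * q) v = peval p v * peval q v"
  unfolding times_expansion[of p q]
  by (simp add: peval_single monom_eval_add peval_eq[of p] peval_eq[of q] sum_product algebra_simps)

lemma peval_PConst [simp]: "peval (PConst c) v = c"
  by (simp add: PConst_def peval_single monom_eval_def)

lemma peval_one [simp]: "peval 1 v = 1"
  using peval_PConst[of 1 v] by (simp add: PConst_def)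

lemma peval_PVar [simp]: "peval (PVar i) v = v i"
  by (simp add: PVar_def peval_single monom_eval_def)

lemma peval_power [simp]: "peval (p ^ k) v = peval p v ^ k"
  by (induction k) auto

lemma peval_form_scale:
  assumes "is_form k q"
  shows "peval q (\<lambda>i. c * v i) = c ^ k * peval q v"
  using assms by (simp add: peval_eq is_form_def monom_eval_scale sum_distrib_left algebra_simps)

lemma peval_cong:
  assumes "vars_in k q" "\<And>i. i < k \<Longrightarrow> v i = w i"
  shows "peval q v = peval q w"
  using assms unfolding peval_def vars_in_def by (intro sum.cong arg_cong2[where f = "(*)"] prod.cong) auto

section \<open>Closure rules for polynomials in finitely many variables and for forms\<close>

lemma vars_in_zero [simp]: "vars_in k 0"
  and vars_in_one [simp]: "vars_in k 1"
  and vars_in_PConst [simp]: "vars_in k (PConst c)"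
  and vars_in_PVar [simp]: "vars_in k (PVar i) \<longleftrightarrow> i < k"
  by (auto simp: vars_in_def PConst_def PVar_def)

lemma vars_in_add [intro]: "vars_in k p \<Longrightarrow> vars_in k q \<Longrightarrow> vars_in k (p + q)"
  using keys_add[of p q] by (auto simp: vars_in_def)

lemma vars_in_diff [intro]: "vars_in k p \<Longrightarrow> vars_in k q \<Longrightarrow> vars_in k (p - q)"
  using keys_diff[of p q] by (auto simp: vars_in_def)

lemma vars_in_mult [intro]: "vars_in k p \<Longrightarrow> vars_in k q \<Longrightarrow> vars_in k (p * q)"
  using keys_mult[of p q] by (fastforce simp: vars_in_def keys_add_nat)

lemma vars_in_power [intro]: "vars_in k p \<Longrightarrow> vars_in k (p ^ j)"
  by (induction j) auto

lemma vars_in_sum [intro]: "(\<And>i. i \<in> I \<Longrightarrow> vars_in k (f i)) \<Longrightarrow> vars_in k (\<Sum>i\<in>I. f i)"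
  by (induction I rule: infinite_finite_induct) auto

lemma is_form_zero [simp]: "is_form k 0"
  and is_form_one [simp]: "is_form 0 1"
  and is_form_PConst [simp]: "is_form 0 (PConst c)"
  and is_form_PVar [simp]: "is_form 1 (PVar i)"
  by (auto simp: is_form_def PConst_def PVar_def)

lemma is_form_add [intro]: "is_form k p \<Longrightarrow> is_form k q \<Longrightarrow> is_form k (p + q)"
  using keys_add[of p q] by (auto simp: is_form_def)

lemma is_form_diff [intro]: "is_form k p \<Longrightarrow> is_form k q \<Longrightarrow> is_form k (p - q)"
  using keys_diff[of p q] by (auto simp: is_form_def)

lemma is_form_mult: "is_form k p \<Longrightarrow> is_form l q \<Longrightarrow> j = k + l \<Longrightarrow> is_form j (p * q)"
  using keys_mult[of p q] by (fastforce simp: is_form_def mon_deg_add)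

lemma is_form_power: "is_form k p \<Longrightarrow> l = j * k \<Longrightarrow> is_form l (p ^ j)"
  by (induction j arbitrary: l) (auto intro: is_form_mult)

lemma is_form_sum [intro]: "(\<And>i. i \<in> I \<Longrightarrow> is_form k (f i)) \<Longrightarrow> is_form k (\<Sum>i\<in>I. f i)"
  by (induction I rule: infinite_finite_induct) auto

section \<open>Sums of squares\<close>

lemma sos_in_zero [simp]: "sos_in k 0"
  unfolding sos_in_def by (rule exI[of _ "[]"]) auto

lemma sos_in_square: "vars_in k p \<Longrightarrow> sos_in k (p * p)"
  unfolding sos_in_def by (rule exI[of _ "[p]"]) auto

lemma sos_in_add [intro]:
  assumes "sos_in k p" "sos_in k q" shows "sos_in k (p + q)"
proof -
  obtain hs gs where "\<forall>h\<in>set hs. vars_in k h" "p = sum_list (map (\<lambda>h. h * h) hs)"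
    "\<forall>h\<in>set gs. vars_in k h" "q = sum_list (map (\<lambda>h. h * h) gs)"
    using assms unfolding sos_in_def by blast
  then show ?thesis unfolding sos_in_def by (intro exI[of _ "hs @ gs"]) auto
qed

lemma sos_in_sum [intro]: "(\<And>i. i \<in> I \<Longrightarrow> sos_in k (f i)) \<Longrightarrow> sos_in k (\<Sum>i\<in>I. f i)"
  by (induction I rule: infinite_finite_induct) auto

text \<open>\<open>(h * h) * (g * g)\<close> is the square of \<open>h * g\<close>; the two
  inductions distribute this over both lists of squares.\<close>

lemma sos_in_mult [intro]:
  assumes "sos_in k p" "sos_in k q" shows "sos_in k (p * q)"
proof -
  have square: "sos_in k (sum_list (map (\<lambda>h. h * h) hs) * (g * g))"
    if "\<forall>h\<in>set hs. vars_in k h" "vars_in k g" for hs and g :: mpoly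
    using that
  proof (induction hs)
    case (Cons h hs)
    have "sos_in k ((h * g) * (h * g))" using Cons by (intro sos_in_square) auto
    then have "sos_in k ((h * g) * (h * g) + sum_list (map (\<lambda>h. h * h) hs) * (g * g))"
      using Cons by auto
    then show ?case by (simp add: algebra_simps)
  qed simp
  obtain gs where gs: "\<forall>g\<in>set gs. vars_in k g" "q = sum_list (map (\<lambda>h. h * h) gs)"
    using assms(2) unfolding sos_in_def by blast
  have "sos_in k (p * sum_list (map (\<lambda>h. h * h) gs))"
    using gs(1)
  proof (induction gs)
    case (Cons g gs)
    have "sos_in k (p * (g * g))"
      using assms(1) square Cons.prems unfolding sos_in_def[of k p] by auto
    then show ?case using Cons by (auto simp: distrib_left)
  qed simp
  then show ?thesis using gs by simp
qed

lemma sos_in_nonneg: "sos_in k p \<Longrightarrow> peval p v \<ge> 0"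
proof -
  have "peval (sum_list (map (\<lambda>h. h * h) hs)) v \<ge> 0" for hs
    by (induction hs) auto
  then show "sos_in k p \<Longrightarrow> peval p v \<ge> 0" unfolding sos_in_def by auto
qed

lemma vars_in_sos: "sos_in k p \<Longrightarrow> vars_in k p"
proof -
  have "\<forall>h\<in>set hs. vars_in k h \<Longrightarrow> vars_in k (sum_list (map (\<lambda>h. h * h) hs))" for hs
    by (induction hs) auto
  then show "sos_in k p \<Longrightarrow> vars_in k p" unfolding sos_in_def by auto
qed

lemma sos_in_const: "c \<ge> 0 \<Longrightarrow> sos_in k (PConst c)"
  using sos_in_square[OF vars_in_PConst, of k "sqrt c"] by (simp add: PConst_def mult_single)


lemma sos_in_one [simp]: "sos_in k 1"
  using sos_in_const[of 1 k] by (simp add: PConst_def)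

lemma sos_in_power [intro]: "sos_in k p \<Longrightarrow> sos_in k (p ^ j)"
  by (induction j) auto

section \<open>Nonnegativity from a nonzero sum of squares multiplier\<close>

text \<open>Along a suitable curve of powers of \<open>t\<close> the polynomial restricts to a
  nonzero polynomial in \<open>t\<close>, which cannot vanish at all reals.\<close>

lemma exists_nonzero_eval:
  assumes "q \<noteq> 0"
  obtains w where "peval q w \<noteq> 0"
proof -
  define V where "V = (\<Union>a\<in>keys q. keys a)"
  have V: "finite V" "\<And>a. a \<in> keys q \<Longrightarrow> keys a \<subseteq> V" by (auto simp: V_def)
  define ip where "ip a b = (\<Sum>i\<in>V. lookup a i * lookup b i)" for a b :: "nat \<Rightarrow>\<^sub>0 nat"
  have "keys q \<noteq> {}" using assms by simp
  then have "Max ((\<lambda>b. ip b b) ` keys q) \<in> (\<lambda>b. ip b b) ` keys q" by (intro Max_in) auto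
  then obtain a where a: "a \<in> keys q" and Max: "Max ((\<lambda>b. ip b b) ` keys q) = ip a a" by blast
  have max: "ip b b \<le> ip a a" if "b \<in> keys q" for b
    unfolding Max[symmetric] using that by (intro Max_ge) auto
  text \<open>The exponent vector of maximal Euclidean norm is the unique maximizer of
    its own inner product, so it yields the leading term along the curve \<open>v\<^sub>i = t ^ a\<^sub>i\<close>.\<close>
  have less: "ip a b < ip a a" if b: "b \<in> keys q" "b \<noteq> a" for b
  proof -
    obtain j where j: "lookup b j \<noteq> lookup a j" using b(2) by (metis poly_mapping_eqI)
    then have "j \<in> keys a \<or> j \<in> keys b" unfolding in_keys_iff by linarith
    then have "j \<in> V" using V(2)[OF a] V(2)[OF b(1)] by blast
    \<comment> \<open>The squared distance of the two exponent vectors is positive; since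
      \<open>ip b b \<le> ip a a\<close>, its expansion forces
      \<open>ip a b < ip a a\<close>.\<close>
    then have "(\<Sum>i\<in>V. (real (lookup a i) - real (lookup b i))\<^sup>2) > 0"
      using j V(1) by (intro sum_pos2[of _ j]) auto
    also have "(\<Sum>i\<in>V. (real (lookup a i) - real (lookup b i))\<^sup>2) = real (ip a a) + real (ip b b) - 2 * real (ip a b)"
      by (simp add: ip_def power2_eq_square algebra_simps sum.distrib sum_subtractf sum_distrib_left)
    finally show ?thesis using max[OF b(1)] by linarith
  qed
  define P where "P = (\<Sum>b\<in>keys q. monom (lookup q b) (ip a b))"
  have "coeff P (ip a a) = (\<Sum>b\<in>keys q. if b = a then lookup q b else 0)"
    unfolding P_def coeff_sum using less by (intro sum.cong) (auto simp: less_imp_neq)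
  also have "\<dots> = lookup q a" using a by simp
  finally have "P \<noteq> 0" using a by (auto simp: in_keys_iff)
  then obtain t where t: "poly P t \<noteq> 0" using poly_all_0_iff_0[of P] by auto
  have "peval q (\<lambda>i. t ^ lookup a i) = poly P t"
    unfolding P_def peval_eq poly_sum poly_monom
    by (intro sum.cong refl, subst monom_eval_superset[OF V])
      (auto simp: ip_def power_sum power_mult)
  then have "peval q (\<lambda>i. t ^ lookup a i) \<noteq> 0" using t by simp
  then show thesis by (rule that)
qed

text \<open>Makes continuity and finiteness of roots in one variable available along lines.\<close>

lemma peval_line_poly:
  obtains P where "\<And>t. poly P t = peval q (\<lambda>i. z i + t * u i)"
proof
  fix t
  show "poly (\<Sum>a\<in>keys q. smult (lookup q a) (\<Prod>i\<in>keys a. [:z i, u i:] ^ lookup a i)) t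
      = peval q (\<lambda>i. z i + t * u i)"
    by (simp add: peval_def poly_sum poly_prod)
qed

text \<open>Since \<open>h\<close> may vanish at \<open>z\<close>, it cannot simply be divided out
  there. On the line from \<open>z\<close> to a point where \<open>h\<close> is nonzero, a negative
  \<open>q\<close> near \<open>z\<close> would force \<open>h = 0\<close> on an interval, although
  \<open>h\<close> has only finitely many roots on that line.\<close>

lemma peval_nonneg_of_mult:
  assumes "h \<noteq> 0" "\<And>v. peval h v \<ge> 0" "\<And>v. peval (q * h) v \<ge> 0"
  shows "peval q z \<ge> 0"
proof (rule ccontr)
  assume neg: "\<not> peval q z \<ge> 0"
  obtain w where w: "peval h w \<noteq> 0" using exists_nonzero_eval assms(1) by blast
  obtain Q where Q: "\<And>t. poly Q t = peval q (\<lambda>i. z i + t * (w i - z i))" using peval_line_poly by metis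
  obtain H where H: "\<And>t. poly H t = peval h (\<lambda>i. z i + t * (w i - z i))" using peval_line_poly by metis
  have "poly H 1 \<noteq> 0" using w by (simp add: H)
  then have "H \<noteq> 0" by auto
  have "isCont (poly Q) 0" by simp
  then have "(poly Q \<longlongrightarrow> poly Q 0) (at 0)" by (simp add: isCont_def)
  moreover have "poly Q 0 < 0" using neg by (simp add: Q)
  ultimately have "\<forall>\<^sub>F t in at 0. poly Q t < 0" by (rule order_tendstoD)
  then obtain e where e: "e > 0" "\<And>t. t \<noteq> 0 \<Longrightarrow> \<bar>t\<bar> < e \<Longrightarrow> poly Q t < 0"
    unfolding eventually_at by (auto simp: dist_real_def)
  have "{0<..<e} \<subseteq> {t. poly H t = 0}"
  proof
    fix t assume t: "t \<in> {0<..<e}"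
    then have "poly Q t < 0" using e(2)[of t] by auto
    moreover have "poly Q t * poly H t \<ge> 0" "poly H t \<ge> 0"
      using assms(3)[of "\<lambda>i. z i + t * (w i - z i)"] assms(2) by (auto simp: Q H)
    ultimately show "t \<in> {t. poly H t = 0}" by (auto simp: zero_le_mult_iff)
  qed
  moreover have "finite {t. poly H t = 0}" using \<open>H \<noteq> 0\<close> by (rule poly_roots_finite)
  ultimately have "finite {0<..<e}" by (rule finite_subset)
  then show False using e(1) infinite_Ioo[of 0 e] by blast
qed

section \<open>Compactness and lower bounds for positive definite forms\<close>

lemma continuous_on_peval: "continuous_on S (peval q)"
  unfolding peval_def
  by (intro continuous_intros continuous_on_subset[OF continuous_on_product_coordinates]) auto

definition pos_def :: "nat \<Rightarrow> mpoly \<Rightarrow> bool" where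
  "pos_def N f \<longleftrightarrow> (\<forall>v. (\<exists>i<N. v i \<noteq> 0) \<longrightarrow> peval f v > 0)"

text \<open>Coordinates from \<open>N\<close> on are fixed at 0, so the sphere is a closed subset of
  a product of compact intervals and points, which is compact by Tychonoff's theorem.\<close>

lemma compact_unit_sphere:
  "compact {v :: nat \<Rightarrow> real. (\<forall>i\<ge>N. v i = 0) \<and> (\<Sum>i<N. (v i)\<^sup>2) = 1}"
proof -
  define B :: "(nat \<Rightarrow> real) set" where "B = PiE UNIV (\<lambda>i. if i < N then {-1..1} else {0})"
  have "compactin (product_topology (\<lambda>i. euclidean) UNIV) B"
    unfolding B_def compactin_PiE by auto
  then have B: "compact B" by (simp add: euclidean_product_topology)
  have c: "closed {v :: nat \<Rightarrow> real. (\<Sum>i<N. (v i)\<^sup>2) = 1}"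
    by (intro closed_Collect_eq continuous_intros) auto
  have "{v :: nat \<Rightarrow> real. (\<forall>i\<ge>N. v i = 0) \<and> (\<Sum>i<N. (v i)\<^sup>2) = 1} = B \<inter> {v. (\<Sum>i<N. (v i)\<^sup>2) = 1}"
  proof -
    have bd: "-1 \<le> v i \<and> v i \<le> 1" if "(\<Sum>i<N. (v i)\<^sup>2) = 1" "i < N" for v :: "nat \<Rightarrow> real" and i
    proof -
      have "(v i)\<^sup>2 \<le> (\<Sum>i<N. (v i)\<^sup>2)" using that by (intro member_le_sum) auto
      then have "\<bar>v i\<bar> \<le> 1" using that by (simp add: abs_square_le_1)
      then show ?thesis by (simp add: abs_le_iff)
    qed
    show ?thesis
    proof (intro set_eqI iffI)
      fix v :: "nat \<Rightarrow> real" assume "v \<in> B \<inter> {v. (\<Sum>i<N. (v i)\<^sup>2) = 1}"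
      then show "v \<in> {v. (\<forall>i\<ge>N. v i = 0) \<and> (\<Sum>i<N. (v i)\<^sup>2) = 1}"
        by (simp add: B_def PiE_iff) (metis leD singletonD)
    qed (use bd in \<open>auto simp: B_def\<close>)
  qed
  then show ?thesis using B c by (simp add: compact_Int_closed)
qed

lemma pos_def_sphere_bound:
  assumes "pos_def N f" "vars_in N f" "N > 0"
  obtains e where "e > 0" "\<And>v. (\<Sum>i<N. (v i)\<^sup>2) = 1 \<Longrightarrow> peval f v \<ge> e"
proof -
  define K where "K = {v :: nat \<Rightarrow> real. (\<forall>i\<ge>N. v i = 0) \<and> (\<Sum>i<N. (v i)\<^sup>2) = 1}"
  have "(\<lambda>i. if i = 0 then 1 else 0) \<in> K"
    using assms(3) by (auto simp: K_def if_distrib[of "\<lambda>x. x\<^sup>2"] cong: if_cong)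
  then have "K \<noteq> {}" by blast
  then obtain w where w: "w \<in> K" "\<And>v. v \<in> K \<Longrightarrow> peval f w \<le> peval f v"
    using continuous_attains_inf[OF _ _ continuous_on_peval, of K f] compact_unit_sphere[of N]
    by (auto simp: K_def)
  have "\<exists>i<N. w i \<noteq> 0"
  proof (rule ccontr)
    assume "\<not> ?thesis"
    then have "(\<Sum>i<N. (w i)\<^sup>2) = 0" by simp
    then show False using w(1) by (simp add: K_def)
  qed
  then have "peval f w > 0" using assms(1) by (auto simp: pos_def_def)
  moreover have "peval f v \<ge> peval f w" if "(\<Sum>i<N. (v i)\<^sup>2) = 1" for v
  proof -
    \<comment> \<open>\<open>v\<close> is arbitrary beyond \<open>N\<close>; cutting it off there
      keeps the value of \<open>f\<close> and yields a point of \<open>K\<close>.\<close>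
    have "peval f v = peval f (\<lambda>i. if i < N then v i else 0)"
      by (rule peval_cong[OF assms(2)]) auto
    moreover have "(\<lambda>i. if i < N then v i else 0) \<in> K" using that by (auto simp: K_def)
    ultimately show ?thesis using w(2) by simp
  qed
  ultimately show thesis using that by blast
qed

text \<open>Homogeneity carries the bound from the unit sphere to all points: with \<open>s\<close>
  the norm of \<open>v\<close>, both sides scale by \<open>s ^ (2 * k)\<close>.\<close>

lemma pos_def_form_bound:
  assumes "pos_def N f" "vars_in N f" "N > 0" "is_form (2 * k) f"
  obtains e where "e > 0" "\<And>v. \<exists>i<N. v i \<noteq> 0 \<Longrightarrow> peval f v \<ge> e * (\<Sum>i<N. (v i)\<^sup>2) ^ k"
proof -
  obtain e where e: "e > 0" "\<And>v. (\<Sum>i<N. (v i)\<^sup>2) = 1 \<Longrightarrow> peval f v \<ge> e"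
    using pos_def_sphere_bound assms by blast
  have "peval f v \<ge> e * (\<Sum>i<N. (v i)\<^sup>2) ^ k" if nz: "\<exists>i<N. v i \<noteq> 0" for v
  proof -
    define s where "s = sqrt (\<Sum>i<N. (v i)\<^sup>2)"
    have s2: "s\<^sup>2 = (\<Sum>i<N. (v i)\<^sup>2)" by (simp add: s_def sum_nonneg)
    have "(\<Sum>i<N. (v i)\<^sup>2) > 0" using nz by (auto intro: sum_pos2)
    then have s0: "s \<noteq> 0" by (simp add: s_def)
    then have v: "v = (\<lambda>i. s * (v i / s))" by auto
    have "(\<Sum>i<N. (v i / s)\<^sup>2) = 1"
      using s0 by (simp add: power_divide sum_divide_distrib[symmetric] s2[symmetric])
    then have "e \<le> peval f (\<lambda>i. v i / s)" by (rule e(2))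
    then have "s ^ (2 * k) * e \<le> s ^ (2 * k) * peval f (\<lambda>i. v i / s)"
      by (intro mult_left_mono) (auto simp: power_mult)
    also have "\<dots> = peval f v" using peval_form_scale[OF assms(4), of s "\<lambda>i. v i / s"] v by simp
    finally show ?thesis unfolding s2[symmetric] power_mult[symmetric] by (simp add: mult.commute)
  qed
  then show thesis using that e(1) by blast
qed


section \<open>Sign changes of variables and even exponents\<close>

text \<open>The substitution of \<open>- x_j\<close> for \<open>x_j\<close>, written on coefficients
  so that it visibly preserves the support.\<close>

definition reflect :: "nat \<Rightarrow> mpoly \<Rightarrow> mpoly" where
  "reflect j f = Poly_Mapping.mapp (\<lambda>a c. (-1) ^ lookup a j * c) f"

lemma lookup_reflect: "lookup (reflect j f) a = (-1) ^ lookup a j * lookup f a"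
  by (simp add: reflect_def lookup_mapp when_def in_keys_iff)

lemma keys_reflect [simp]: "keys (reflect j f) = keys f"
  by (auto simp: in_keys_iff lookup_reflect)

lemma reflect_add: "reflect j (p + q) = reflect j p + reflect j q"
  by (rule poly_mapping_eqI) (simp add: lookup_reflect lookup_add algebra_simps)

lemma reflect_sum: "reflect j (\<Sum>i\<in>I. f i) = (\<Sum>i\<in>I. reflect j (f i))"
  by (rule poly_mapping_eqI) (simp add: lookup_reflect lookup_sum sum_distrib_left)

lemma reflect_single: "reflect j (single a c) = single a ((-1) ^ lookup a j * c)"
  by (rule poly_mapping_eqI) (simp add: lookup_reflect lookup_single when_def)

lemma reflect_mult: "reflect j (p * q) = reflect j p * reflect j q"
  unfolding times_expansion[of p q] times_expansion[of "reflect j p" "reflect j q"]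
  by (simp add: reflect_sum reflect_single lookup_reflect lookup_add power_add mult_ac)

lemma reflect_reflect [simp]: "reflect j (reflect j f) = f"
  by (rule poly_mapping_eqI) (simp add: lookup_reflect)

lemma reflect_commute: "reflect i (reflect j f) = reflect j (reflect i f)"
  by (rule poly_mapping_eqI) (simp add: lookup_reflect)

lemma vars_in_reflect [simp]: "vars_in k (reflect j f) \<longleftrightarrow> vars_in k f"
  and is_form_reflect [simp]: "is_form k (reflect j f) \<longleftrightarrow> is_form k f"
  by (auto simp: vars_in_def is_form_def)

lemma peval_reflect: "peval (reflect j f) v = peval f (v(j := - v j))"
proof -
  have "(-1) ^ lookup a j * monom_eval v a = monom_eval (v(j := - v j)) a" for a
  proof -
    let ?I = "insert j (keys a)"
    \<comment> \<open>Inserting \<open>j\<close> also covers monomials without this variable, whose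
      factor at \<open>j\<close> is 1.\<close>
    have "monom_eval w a = w j ^ lookup a j * (\<Prod>i\<in>?I - {j}. w i ^ lookup a i)" for w
      by (subst monom_eval_superset[of ?I]) (auto simp: prod.remove[of ?I j])
    then show ?thesis by (simp add: power_minus[of "v j"])
  qed
  then show ?thesis unfolding peval_eq keys_reflect lookup_reflect by (intro sum.cong refl) (metis mult.assoc mult.commute)
qed

lemma pos_def_reflect:
  assumes "pos_def N f"
  shows "pos_def N (reflect j f)"
  unfolding pos_def_def peval_reflect
proof (intro allI impI)
  fix v :: "nat \<Rightarrow> real" assume "\<exists>i<N. v i \<noteq> 0"
  then have "\<exists>i<N. (v(j := - v j)) i \<noteq> 0" by auto
  then show "peval f (v(j := - v j)) > 0" using assms unfolding pos_def_def by blast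
qed

text \<open>An odd exponent at \<open>j\<close> would make the coefficient equal to its own
  negative.\<close>

lemma even_of_reflect_eq: "reflect j f = f \<Longrightarrow> a \<in> keys f \<Longrightarrow> even (lookup a j)"
  using lookup_reflect[of j f a] by (cases "even (lookup a j)") (auto simp: in_keys_iff)

lemma obtain_half:
  fixes a :: "nat \<Rightarrow>\<^sub>0 nat"
  assumes "\<And>j. even (lookup a j)"
  obtains a' where "a = a' + a'"
proof
  have half: "lookup a k = lookup a k div 2 + lookup a k div 2" for k
    using assms[of k] by (auto elim: evenE)
  show "a = Poly_Mapping.map (\<lambda>x. x div 2) a + Poly_Mapping.map (\<lambda>x. x div 2) a"
    by (intro poly_mapping_eqI, subst lookup_add) (auto simp: Poly_Mapping.map.rep_eq when_def intro: half)
qed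

section \<open>Polya's theorem for forms in the squares of the variables\<close>

lemma lookup_mult_single_sum:
  fixes f :: mpoly
  assumes "finite C"
  shows "lookup (f * (\<Sum>c\<in>C. single (s c) (w c))) b
    = (\<Sum>a\<in>keys f. lookup f a * (\<Sum>c\<in>C. if a + s c = b then w c else 0))"
proof -
  have "f * (\<Sum>c\<in>C. single (s c) (w c)) = (\<Sum>a\<in>keys f. \<Sum>c\<in>C. single (a + s c) (lookup f a * w c))"
    by (subst poly_mapping_expansion[of f]) (simp only: sum_product mult_single)
  then show ?thesis
    by (simp add: lookup_sum lookup_single when_def sum_distrib_left if_distrib[of "\<lambda>x. _ * x"] cong: if_cong)
qed

definition exps :: "nat \<Rightarrow> nat \<Rightarrow> (nat \<Rightarrow>\<^sub>0 nat) set" where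
  "exps N k = {c. keys c \<subseteq> {..<N} \<and> mon_deg c = k}"

text \<open>Every exponent is at most the total degree, so restriction to \<open>{..<N}\<close>
  embeds the set in a finite function space.\<close>

lemma finite_exps: "finite (exps N k)"
proof (rule inj_on_finite)
  show "inj_on (\<lambda>c. restrict (lookup c) {..<N}) (exps N k)"
  proof (rule inj_onI)
    fix a b assume ab: "a \<in> exps N k" "b \<in> exps N k"
      and eq: "restrict (lookup a) {..<N} = restrict (lookup b) {..<N}"
    show "a = b"
    proof (rule poly_mapping_eqI)
      fix i
      show "lookup a i = lookup b i"
      proof (cases "i < N")
        case True
        then show ?thesis using fun_cong[OF eq, of i] by simp
      next
        case False
        then have "i \<notin> keys a" "i \<notin> keys b" using ab by (auto simp: exps_def)
        then show ?thesis by (simp add: in_keys_iff)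
      qed
    qed
  qed
  show "(\<lambda>c. restrict (lookup c) {..<N}) ` exps N k \<subseteq> PiE {..<N} (\<lambda>_. {..k})"
  proof
    fix g assume "g \<in> (\<lambda>c. restrict (lookup c) {..<N}) ` exps N k"
    then obtain c where c: "c \<in> exps N k" and g: "g = restrict (lookup c) {..<N}" by blast
    have "lookup c i \<le> k" if "i < N" for i
    proof -
      have "lookup c i \<le> (\<Sum>i<N. lookup c i)" using that by (intro member_le_sum) auto
      also have "\<dots> = k" using c mon_deg_superset[of "{..<N}" c] by (simp add: exps_def)
      finally show ?thesis .
    qed
    then show "g \<in> PiE {..<N} (\<lambda>_. {..k})" by (auto simp: g)
  qed
  show "finite (PiE {..<N} (\<lambda>_. {..k}))" by (intro finite_PiE) auto
qed

text \<open>Up to the factor \<open>k!\<close> this is the power \<open>(\<Sum>i<N. x\<^sub>i\<^sup>2) ^ k\<close> of Polya's theorem, but taking the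
  expanded form as the definition avoids the multinomial theorem.\<close>

definition polya_mult :: "nat \<Rightarrow> nat \<Rightarrow> mpoly" where
  "polya_mult N k = (\<Sum>c\<in>exps N k. single (c + c) (1 / (\<Prod>i<N. fact (lookup c i))))"

lemma vars_in_single: "vars_in k (single a c) \<longleftrightarrow> c = 0 \<or> keys a \<subseteq> {..<k}"
  by (auto simp: vars_in_def)

lemma is_form_single: "is_form k (single a c) \<longleftrightarrow> c = 0 \<or> mon_deg a = k"
  by (auto simp: is_form_def)

lemma sos_in_single:
  assumes "c \<ge> 0" "keys a \<subseteq> {..<N}"
  shows "sos_in N (single (a + a) c)"
  using sos_in_square[of N "single a (sqrt c)"] assms by (simp add: vars_in_single mult_single)

lemma polya_mult_props:
  shows "vars_in N (polya_mult N k)" "is_form (2 * k) (polya_mult N k)" "sos_in N (polya_mult N k)"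
proof -
  show "sos_in N (polya_mult N k)" unfolding polya_mult_def
    by (intro sos_in_sum sos_in_single) (auto simp: exps_def intro!: prod_nonneg)
  then show "vars_in N (polya_mult N k)" by (rule vars_in_sos)
  show "is_form (2 * k) (polya_mult N k)" unfolding polya_mult_def
    by (intro is_form_sum) (auto simp: is_form_single mon_deg_add exps_def)
qed

lemma polya_mult_nonzero:
  assumes "N > 0"
  shows "polya_mult N k \<noteq> 0"
proof
  assume "polya_mult N k = 0"
  then have "0 = peval (polya_mult N k) (\<lambda>i. 1)" by simp
  also have "\<dots> = (\<Sum>c\<in>exps N k. 1 / (\<Prod>i<N. fact (lookup c i)))"
    unfolding polya_mult_def by (simp add: peval_single monom_eval_def)
  also have "\<dots> > 0"
  proof (rule sum_pos)
    \<comment> \<open>\<open>N > 0\<close> provides the monomial \<open>x_0 ^ k\<close>.\<close>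
    have "single 0 k \<in> exps N k" using assms by (auto simp: exps_def)
    then show "exps N k \<noteq> {}" by blast
  qed (auto simp: finite_exps intro!: prod_pos)
  finally show False by simp
qed

text \<open>Serves to rewrite the weights of \<open>polya_mult\<close>: for
  \<open>c = b - a\<close>, the reciprocal factorial of \<open>c\<close> is a falling factorial of
  \<open>b\<close> over the factorial of \<open>b\<close>.\<close>

lemma fact_eq_falling: "(\<Prod>j<a. real (b + a - j)) * fact b = fact (b + a)"
proof (induction a)
  case (Suc a)
  have "(\<Prod>j<Suc a. real (b + Suc a - j)) = real (b + Suc a) * (\<Prod>j<a. real (b + a - j))"
    by (simp add: prod.lessThan_Suc_shift del: prod.lessThan_Suc of_nat_add of_nat_diff)
  also have "\<dots> * fact b = real (b + Suc a) * ((\<Prod>j<a. real (b + a - j)) * fact b)"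
    by (simp only: mult.assoc)
  finally show ?case unfolding Suc by (simp add: algebra_simps)
qed simp

text \<open>Only \<open>c = b - a\<close> can contribute. If some exponent of \<open>b\<close> is
  smaller than that of \<open>a\<close>, no such \<open>c\<close> exists, and the right side
  vanishes through its factor at \<open>j = lookup b i\<close>.\<close>

lemma polya_coeff_term:
  assumes a: "keys a \<subseteq> {..<N}" "mon_deg a = e" and b: "keys b \<subseteq> {..<N}" "mon_deg b = k + e"
  shows "(\<Sum>c\<in>exps N k. if (a + a) + (c + c) = b + b then 1 / (\<Prod>i<N. fact (lookup c i)) else 0)
    = (\<Prod>i<N. \<Prod>j<lookup a i. real (lookup b i - j)) / (\<Prod>i<N. fact (lookup b i))"
    (is "?L = ?R")
proof (cases "\<exists>c\<in>exps N k. b = a + c")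
  case True
  then obtain c where c: "c \<in> exps N k" "b = a + c" by blast
  have iff: "(a + a) + (c' + c') = b + b \<longleftrightarrow> c' = c" for c'
  proof -
    have "(a + a) + (c' + c') = b + b \<longleftrightarrow> (\<forall>i. lookup c' i = lookup c i)"
      unfolding c(2) poly_mapping_eq_iff fun_eq_iff lookup_add by (intro iff_allI) auto
    then show ?thesis by (metis poly_mapping_eqI)
  qed
  have L: "?L = 1 / (\<Prod>i<N. fact (lookup c i))"
    using c(1) by (simp add: iff finite_exps)
  have "(\<Prod>i<N. \<Prod>j<lookup a i. real (lookup b i - j)) * (\<Prod>i<N. fact (lookup c i))
      = (\<Prod>i<N. fact (lookup b i))"
    unfolding prod.distrib[symmetric] c(2) lookup_add
    by (intro prod.cong refl, subst add.commute, subst (2) add.commute) (simp only: fact_eq_falling)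
  moreover have "(\<Prod>i<N. fact (lookup b i)) \<noteq> (0::real)" "(\<Prod>i<N. fact (lookup c i)) \<noteq> (0::real)"
    by auto
  ultimately have "?R = 1 / (\<Prod>i<N. fact (lookup c i))"
    by (simp add: frac_eq_eq)
  then show ?thesis using L by (simp only:)
next
  case False
  \<comment> \<open>Otherwise \<open>b - a\<close> would be an admissible \<open>c\<close>; beyond
    \<open>N\<close> the exponents of \<open>a\<close> are 0, so no comparison can fail
    there.\<close>
  have "\<exists>i<N. lookup b i < lookup a i"
  proof (rule ccontr)
    assume neg: "\<not> ?thesis"
    have le: "lookup a i \<le> lookup b i" for i
    proof (cases "i < N")
      case False
      then have "i \<notin> keys a" using a(1) by auto
      then show ?thesis by (simp add: in_keys_iff)
    qed (use neg not_le in blast)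
    have eq: "b = a + (b - a)"
      using le by (intro poly_mapping_eqI) (simp add: lookup_add lookup_minus)
    have "b - a \<in> exps N k"
      using b eq a mon_deg_add[of a "b - a"] keys_add_nat[of a "b - a"] by (auto simp: exps_def)
    then show False using False eq by blast
  qed
  then have "(\<Prod>i<N. \<Prod>j<lookup a i. real (lookup b i - j)) = 0"
    by (auto simp: prod_zero_iff)
  moreover have "(a + a) + (c + c) \<noteq> b + b" if "c \<in> exps N k" for c
  proof
    assume "(a + a) + (c + c) = b + b"
    then have "\<forall>i. lookup a i + lookup a i + (lookup c i + lookup c i) = lookup b i + lookup b i"
      unfolding poly_mapping_eq_iff fun_eq_iff lookup_add .
    then have "lookup b i = lookup a i + lookup c i" for i by (auto dest: spec[of _ i])
    then have "b = a + c" by (intro poly_mapping_eqI) (simp add: lookup_add)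
    then show False using False that by blast
  qed
  ultimately show ?thesis by simp
qed

text \<open>\<open>h\<close> picks the half of each exponent vector of \<open>f\<close>. The
  factorials of \<open>b\<close> are a common positive denominator, so the sign is decided by a sum
  that resembles a value of \<open>f\<close>.\<close>

lemma polya_coeff:
  assumes even: "\<And>a. a \<in> keys f \<Longrightarrow> h a + h a = a" and f: "vars_in N f" "is_form (2 * e) f"
    and b: "keys b \<subseteq> {..<N}" "mon_deg b = k + e"
  shows "lookup (f * polya_mult N k) (b + b) = (\<Sum>a\<in>keys f. lookup f a *
      (\<Prod>i<N. \<Prod>j<lookup (h a) i. real (lookup b i - j))) / (\<Prod>i<N. fact (lookup b i))"
proof -
  have "(\<Sum>c\<in>exps N k. if a + (c + c) = b + b then 1 / (\<Prod>i<N. fact (lookup c i)) else 0)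
     = (\<Prod>i<N. \<Prod>j<lookup (h a) i. real (lookup b i - j)) / (\<Prod>i<N. fact (lookup b i))"
    if a: "a \<in> keys f" for a
  proof -
    have "keys (h a) \<subseteq> {..<N}" "mon_deg (h a) = e"
      using f a even[OF a] keys_add_nat[of "h a" "h a"] mon_deg_add[of "h a" "h a"]
      by (auto simp: vars_in_def is_form_def)
    from polya_coeff_term[OF this b] show ?thesis by (simp only: even[OF a])
  qed
  then show ?thesis unfolding polya_mult_def
    by (simp add: lookup_mult_single_sum[OF finite_exps] sum_divide_distrib)
qed

text \<open>The scaled falling factorials \<open>b (b - 1) \<dots> (b - s + 1) / M ^ s\<close> converge to
  \<open>(b / M) ^ s\<close> at rate \<open>1 / M\<close>, uniformly in \<open>b \<le> M\<close>.\<close>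

lemma falling_approx:
  assumes "\<And>i. i < N \<Longrightarrow> b i \<le> M" "M > 0"
  shows "\<bar>(\<Prod>i<N. (\<Prod>j<s i. real (b i - j) / real M)) - (\<Prod>i<N. (real (b i) / real M) ^ s i)\<bar>
    \<le> (\<Sum>i<N. (real (s i))\<^sup>2) / real M"
proof -
  have le1: "real (x - j) / real M \<le> 1" if "x \<le> M" for x j
    using that assms(2) by (simp add: divide_le_eq_1)
  \<comment> \<open>All factors lie in \<open>[0, 1]\<close>, so products differ by at most the sum
    of the differences of their factors. The same estimate is used again for each inner
    product.\<close>
  have "norm ((\<Prod>i<N. (\<Prod>j<s i. real (b i - j) / real M)) - (\<Prod>i<N. (real (b i) / real M) ^ s i))
    \<le> (\<Sum>i<N. norm ((\<Prod>j<s i. real (b i - j) / real M) - (real (b i) / real M) ^ s i))"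
    using assms le1 le1[of _ 0]
    by (intro norm_prod_diff) (auto simp: abs_prod power_abs intro!: prod_le_1 power_le_one)
  also have "\<dots> \<le> (\<Sum>i<N. (real (s i))\<^sup>2 / real M)"
  proof (intro sum_mono)
    fix i assume "i \<in> {..<N}"
    then have bi: "b i \<le> M" using assms(1) by simp
    have "norm ((\<Prod>j<s i. real (b i - j) / real M) - (\<Prod>j<s i. real (b i) / real M))
      \<le> (\<Sum>j<s i. norm (real (b i - j) / real M - real (b i) / real M))"
      using bi le1 le1[of _ 0] by (intro norm_prod_diff) auto
    \<comment> \<open>Subtracting \<open>j < s i\<close> changes \<open>b i\<close> by at most
      \<open>s i\<close>, also where the subtraction is truncated at 0.\<close>
    also have "\<dots> \<le> (\<Sum>j<s i. real (s i) / real M)"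
      by (intro sum_mono) (auto simp: abs_le_iff divide_right_mono simp flip: diff_divide_distrib)
    also have "\<dots> = (real (s i))\<^sup>2 / real M" by (simp add: power2_eq_square)
    finally show "norm ((\<Prod>j<s i. real (b i - j) / real M) - (real (b i) / real M) ^ s i)
      \<le> (real (s i))\<^sup>2 / real M" by simp
  qed
  finally show ?thesis by (simp add: sum_divide_distrib)
qed

text \<open>Each term is a nonnegative multiple of a squared monomial.\<close>

lemma sos_in_even_nonneg:
  assumes "vars_in N q" "\<And>a. a \<in> keys q \<Longrightarrow> \<exists>a'. a = a' + a'" "\<And>a. lookup q a \<ge> 0"
  shows "sos_in N q"
proof -
  have "sos_in N (single a (lookup q a))" if a: "a \<in> keys q" for a
  proof -
    obtain a' where a': "a = a' + a'" using assms(2) a by blast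
    then have "keys a' \<subseteq> {..<N}" using assms(1) a by (auto simp: vars_in_def keys_add_nat)
    then show ?thesis unfolding a' by (intro sos_in_single assms(3))
  qed
  then show ?thesis by (subst poly_mapping_expansion) auto
qed

text \<open>Up to a positive factor, the coefficient at \<open>b + b\<close> is close to the value
  of \<open>f\<close> at the point with coordinates \<open>sqrt (b_i / M)\<close> of the unit
  sphere, where \<open>f\<close> is at least \<open>\<epsilon>\<close>. For large \<open>k\<close>
  the error is at most \<open>\<epsilon>\<close>, so all coefficients are nonnegative.\<close>

theorem polya_sos:
  assumes f: "vars_in N f" "is_form (2 * e) f" "pos_def N f" "N > 0"
    and even: "\<And>a. a \<in> keys f \<Longrightarrow> \<exists>a'. a = a' + a'"
  obtains k where "sos_in N (f * polya_mult N k)"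
proof -
  obtain h where h: "\<And>a. a \<in> keys f \<Longrightarrow> h a + h a = a" using even by metis
  obtain \<epsilon> where \<epsilon>: "\<epsilon> > 0" "\<And>v. (\<Sum>i<N. (v i)\<^sup>2) = 1 \<Longrightarrow> peval f v \<ge> \<epsilon>"
    using pos_def_sphere_bound f by blast
  \<comment> \<open>The error of \<open>falling_approx\<close> without its factor
    \<open>1 / M\<close>, weighted by the coefficients of \<open>f\<close>.\<close>
  define C where "C = (\<Sum>a\<in>keys f. \<bar>lookup f a\<bar> * (\<Sum>i<N. (real (lookup (h a) i))\<^sup>2))"
  have C0: "C \<ge> 0" unfolding C_def by (intro sum_nonneg mult_nonneg_nonneg) auto
  obtain k :: nat where k: "real k > C / \<epsilon>" using reals_Archimedean2 by blast
  have "C / \<epsilon> \<ge> 0" using C0 \<epsilon>(1) by simp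
  then have k0: "k > 0" using k by (cases k) auto
  \<comment> \<open>Half the degree of the product, hence the degree of every \<open>b\<close>
    considered.\<close>
  define M where "M = k + e"
  have M: "M > 0" "C / real M \<le> \<epsilon>"
  proof -
    have "C < \<epsilon> * real k" using k \<epsilon>(1) by (simp add: field_simps)
    also have "\<dots> \<le> \<epsilon> * real M" using \<epsilon>(1) by (simp add: M_def)
    finally show "C / real M \<le> \<epsilon>" using k0 by (simp add: M_def field_simps)
  qed (use k0 in \<open>simp add: M_def\<close>)
  have hdeg: "mon_deg (h a) = e" "keys (h a) \<subseteq> {..<N}" if "a \<in> keys f" for a
    using f(1,2) that h[OF that] keys_add_nat[of "h a" "h a"] mon_deg_add[of "h a" "h a"]
    by (auto simp: vars_in_def is_form_def)
  have main: "lookup (f * polya_mult N k) (b + b) \<ge> 0" if b: "keys b \<subseteq> {..<N}" "mon_deg b = M" for b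
  proof -
    define \<phi> where "\<phi> a = (\<Prod>i<N. \<Prod>j<lookup (h a) i. real (lookup b i - j) / real M)" for a
    define \<psi> where "\<psi> a = (\<Prod>i<N. (real (lookup b i) / real M) ^ lookup (h a) i)" for a
    define v where "v i = sqrt (real (lookup b i) / real M)" for i
    have sumb: "(\<Sum>i<N. lookup b i) = M" using b mon_deg_superset[of "{..<N}" b] by simp
    have bM: "lookup b i \<le> M" if "i < N" for i
      unfolding sumb[symmetric] using that by (intro member_le_sum) auto
    have "(\<Sum>i<N. (v i)\<^sup>2) = real (\<Sum>i<N. lookup b i) / real M"
      by (simp add: v_def sum_divide_distrib)
    then have "peval f v \<ge> \<epsilon>" using M(1) by (intro \<epsilon>(2)) (simp only: sumb, simp)
    moreover have "peval f v = (\<Sum>a\<in>keys f. lookup f a * \<psi> a)"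
      unfolding peval_eq
    proof (intro sum.cong refl arg_cong2[where f = "(*)"])
      fix a assume a: "a \<in> keys f"
      have "monom_eval v a = monom_eval v (h a) * monom_eval v (h a)"
        using h[OF a] monom_eval_add[of v "h a" "h a"] by simp
      also have "\<dots> = (\<Prod>i<N. (v i)\<^sup>2 ^ lookup (h a) i)"
        using hdeg(2)[OF a]
        by (simp add: monom_eval_superset[of "{..<N}"] prod.distrib[symmetric] power_mult_distrib[symmetric] power2_eq_square del: real_sqrt_mult_self)
      finally show "monom_eval v a = \<psi> a" by (simp add: \<psi>_def v_def)
    qed
    moreover have "\<bar>(\<Sum>a\<in>keys f. lookup f a * \<phi> a) - (\<Sum>a\<in>keys f. lookup f a * \<psi> a)\<bar> \<le> C / real M"
    proof -
      have "\<bar>(\<Sum>a\<in>keys f. lookup f a * \<phi> a) - (\<Sum>a\<in>keys f. lookup f a * \<psi> a)\<bar>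
        = \<bar>\<Sum>a\<in>keys f. lookup f a * (\<phi> a - \<psi> a)\<bar>"
        by (simp add: sum_subtractf right_diff_distrib)
      also have "\<dots> \<le> (\<Sum>a\<in>keys f. \<bar>lookup f a * (\<phi> a - \<psi> a)\<bar>)" by (rule sum_abs)
      also have "\<dots> \<le> (\<Sum>a\<in>keys f. \<bar>lookup f a\<bar> * ((\<Sum>i<N. (real (lookup (h a) i))\<^sup>2) / real M))"
        unfolding abs_mult \<phi>_def \<psi>_def
        by (intro sum_mono mult_left_mono falling_approx bM M(1)) auto
      also have "\<dots> = C / real M" by (simp add: C_def sum_divide_distrib[where A = "keys f"])
      finally show ?thesis .
    qed
    ultimately have "(\<Sum>a\<in>keys f. lookup f a * \<phi> a) \<ge> 0" using M(2) by linarith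
    \<comment> \<open>The double product has \<open>e\<close> factors in total, each of which was
      divided by \<open>M\<close> in \<open>\<phi>\<close>.\<close>
    moreover have "(\<Prod>i<N. \<Prod>j<lookup (h a) i. real (lookup b i - j)) = real M ^ e * \<phi> a" if "a \<in> keys f" for a
    proof -
      have "(\<Sum>i<N. lookup (h a) i) = e" using hdeg[OF that] mon_deg_superset[of "{..<N}" "h a"] by simp
      then show ?thesis using M(1) by (simp add: \<phi>_def prod_dividef flip: power_sum)
    qed
    ultimately have "(\<Sum>a\<in>keys f. lookup f a * (\<Prod>i<N. \<Prod>j<lookup (h a) i. real (lookup b i - j))) \<ge> 0"
      by (simp add: mult.left_commute[of _ "real M ^ e"] flip: sum_distrib_left)
    then show ?thesis
      using b unfolding M_def
      by (subst polya_coeff[OF h f(1,2)]) (auto intro!: divide_nonneg_nonneg prod_nonneg)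
  qed
  have "sos_in N (f * polya_mult N k)"
  proof (rule sos_in_even_nonneg)
    show vars: "vars_in N (f * polya_mult N k)" using f polya_mult_props by blast
    show half: "\<exists>a'. a = a' + a'" if a: "a \<in> keys (f * polya_mult N k)" for a
    proof -
      obtain x y where xy: "a = x + y" "x \<in> keys f" "y \<in> keys (polya_mult N k)"
        using keys_mult[of f "polya_mult N k"] a by blast
      then obtain c where "y = c + c"
        using keys_sum[of "\<lambda>c. single (c + c) (1 / (\<Prod>i<N. fact (lookup c i)))" "exps N k"]
        unfolding polya_mult_def by (auto split: if_splits)
      moreover have "x = h x + h x" using h[OF xy(2)] by simp
      ultimately have "a = (h x + c) + (h x + c)" using xy(1) by (metis add.assoc add.commute)
      then show ?thesis by blast
    qed
    show "lookup (f * polya_mult N k) a \<ge> 0" for a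
    proof (cases "a \<in> keys (f * polya_mult N k)")
      case True
      then obtain b where b: "a = b + b" using half by blast
      have "is_form (2 * M) (f * polya_mult N k)"
        by (rule is_form_mult[OF f(2) polya_mult_props(2)]) (simp add: M_def)
      then have "mon_deg b = M" "keys b \<subseteq> {..<N}"
        using True vars by (auto simp: b is_form_def vars_in_def keys_add_nat mon_deg_add)
      then show ?thesis unfolding b by (intro main)
    qed (simp add: in_keys_iff)
  qed
  then show thesis by (rule that)
qed

section \<open>Habicht's theorem\<close>

text \<open>Habicht's theorem, by averaging over sign changes: \<open>A = f + f\<^sup>-\<close> and \<open>B = f f\<^sup>-\<close> are even
  in the reflected variable and \<open>A f = f\<^sup>2 + B\<close>, so denominators for \<open>A\<close> and \<open>B\<close> yield one for \<open>f\<close>.\<close>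

lemma habicht_aux:
  assumes "k \<le> N" "N > 0" "vars_in N f" "is_form (2 * e) f" "pos_def N f"
    "\<And>j. k \<le> j \<Longrightarrow> j < N \<Longrightarrow> reflect j f = f"
  shows "\<exists>h r. h \<noteq> 0 \<and> is_form (2 * r) h \<and> sos_in N h \<and> sos_in N (f * h)"
  using assms
proof (induction k arbitrary: f e)
  case 0
  \<comment> \<open>Invariance under every sign change makes all exponents even, so Polya's theorem
    applies.\<close>
  have "\<exists>a'. a = a' + a'" if a: "a \<in> keys f" for a
  proof -
    have "even (lookup a j)" for j
    proof (cases "j < N")
      case True
      then show ?thesis using even_of_reflect_eq[OF _ a] 0 by blast
    next
      case False
      then have "j \<notin> keys a" using 0 a by (auto simp: vars_in_def)
      then show ?thesis by (simp add: in_keys_iff)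
    qed
    then show ?thesis by (metis obtain_half)
  qed
  then obtain r where "sos_in N (f * polya_mult N r)" using polya_sos 0 by blast
  then show ?case using polya_mult_props polya_mult_nonzero 0 by blast
next
  case (Suc k)
  define A where "A = f + reflect k f"
  define B where "B = f * reflect k f"
  have pd: "pos_def N (reflect k f)" using Suc.prems by (intro pos_def_reflect) auto
  have sym: "reflect j (reflect k f) = reflect k f" if "Suc k \<le> j" "j < N" for j
    using Suc.prems(6)[OF that] by (metis reflect_commute)
  \<comment> \<open>For \<open>j = k\<close> the reflection swaps \<open>f\<close> and
    \<open>reflect k f\<close>; for larger \<open>j\<close> it fixes both.\<close>
  have even: "reflect j A = A" "reflect j B = B" if "k \<le> j" "j < N" for j
    using Suc.prems(6)[of j] sym[of j] that unfolding A_def B_def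
    by (cases "j = k"; simp add: reflect_add reflect_mult add.commute mult.commute)+
  have "pos_def N A" using pd Suc.prems by (auto simp: A_def pos_def_def add_pos_pos)
  moreover have "pos_def N B" using pd Suc.prems by (auto simp: B_def pos_def_def)
  moreover have "vars_in N A" "vars_in N B" "is_form (2 * e) A" "is_form (2 * (2 * e)) B"
    using Suc.prems by (auto simp: A_def B_def intro: is_form_mult)
  \<comment> \<open>\<open>B\<close> has twice the degree of \<open>f\<close>, which is why
    \<open>e\<close> is generalized in the induction.\<close>
  ultimately obtain g r h s where g: "g \<noteq> 0" "is_form (2 * r) g" "sos_in N g" "sos_in N (A * g)"
    and h: "h \<noteq> 0" "is_form (2 * s) h" "sos_in N h" "sos_in N (B * h)"
    using Suc.IH[of A e] Suc.IH[of B "2 * e"] Suc.prems(1,2) even by (metis Suc_leD)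
  have "A \<noteq> 0"
  proof
    assume "A = 0"
    then have "peval A (\<lambda>_. 1) = 0" by simp
    then show False using \<open>pos_def N A\<close> \<open>N > 0\<close> unfolding pos_def_def by (metis less_irrefl zero_neq_one)
  qed
  then have "A * g * h \<noteq> 0" using g h by simp
  moreover have "is_form (2 * (e + r + s)) (A * g * h)"
    by (rule is_form_mult[OF is_form_mult[OF \<open>is_form (2 * e) A\<close> g(2) refl] h(2)]) simp
  moreover have "sos_in N (A * g * h)" using g h by blast
  moreover have "sos_in N (f * (A * g * h))"
  proof -
    \<comment> \<open>This is \<open>A * f = f * f + B\<close> multiplied by both denominators;
      \<open>B * h\<close> is a sum of squares by the choice of \<open>h\<close>.\<close>
    have "f * (A * g * h) = (f * f) * (g * h) + (B * h) * g"
      by (simp add: A_def B_def algebra_simps)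
    moreover have "sos_in N (f * f)" using Suc.prems by (intro sos_in_square) auto
    ultimately show ?thesis using g h by auto
  qed
  ultimately show ?case by blast
qed

text \<open>With \<open>k = N\<close> the symmetry hypothesis of \<open>habicht_aux\<close> is
  vacuous.\<close>

theorem habicht:
  assumes "N > 0" "vars_in N f" "is_form (2 * e) f" "pos_def N f"
  shows "\<exists>h r. h \<noteq> 0 \<and> is_form (2 * r) h \<and> sos_in N h \<and> sos_in N (f * h)"
  using habicht_aux[of N N f e] assms by auto


section \<open>Zeros and positive definiteness of \<open>f_gamma\<close>\<close>

lemma monom_eval_single [simp]: "monom_eval v (single i k) = v i ^ k"
  by (simp add: monom_eval_def)

lemma peval_homog_one: "v yi = 1 \<Longrightarrow> peval (homog yi k q) v = peval q v"
  unfolding homog_def peval_eq[of q] by (simp add: peval_single monom_eval_add)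

text \<open>The degree bound keeps the subtraction \<open>k - mon_deg a\<close> from being
  truncated.\<close>

lemma is_form_homog: "deg_le k q \<Longrightarrow> is_form k (homog yi k q)"
  unfolding homog_def by (intro is_form_sum) (auto simp: is_form_single mon_deg_add deg_le_def)

lemma vars_in_homog:
  assumes "vars_in n q" "n \<le> N" "yi < N"
  shows "vars_in N (homog yi k q)"
  unfolding homog_def
proof (intro vars_in_sum)
  fix a assume "a \<in> keys q"
  then have "keys a \<subseteq> {..<N}" using assms by (force simp: vars_in_def)
  then show "vars_in N (single (a + single yi (k - mon_deg a)) (lookup q a))"
    using assms(3) by (auto simp: vars_in_single keys_add_nat)
qed

lemma vars_in_f_gamma:
  assumes "vars_in n p" "\<forall>i<m. vars_in n (g i)"
  shows "vars_in (n + m + 3) (f_gamma n m d R eta \<beta> p g \<gamma>)"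
  unfolding f_gamma_def Let_def
  using assms
  by (intro vars_in_add vars_in_power vars_in_diff vars_in_sum vars_in_mult) (auto intro!: vars_in_homog)

lemma is_form_f_gamma:
  assumes "deg_le (2 * d) p" "\<forall>i<m. deg_le (2 * d) (g i)" "d \<ge> 1"
  shows "is_form (2 * (2 * d)) (f_gamma n m d R eta \<beta> p g \<gamma>)"
proof -
  have Y: "is_form (2 * d) (PConst c * PVar j ^ (2 * d))" for c j
    by (rule is_form_mult[OF is_form_PConst is_form_power[OF is_form_PVar refl]]) simp
  \<comment> \<open>\<open>d \<ge> 1\<close> ensures \<open>2 + (2 * d - 2) = 2 * d\<close> in the
    natural numbers.\<close>
  have sY: "is_form (2 * d) (PVar i ^ 2 * PVar j ^ (2 * d - 2))" for i j
    by (rule is_form_mult[OF is_form_power[OF is_form_PVar refl] is_form_power[OF is_form_PVar refl]])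
      (use assms(3) in auto)
  have sq: "is_form 2 (PVar i ^ 2)" for i by (rule is_form_power[OF is_form_PVar]) simp
  have s: "is_form (2 * d) (PVar j ^ (2 * d))" for j
    by (rule is_form_power[OF is_form_PVar]) simp
  show ?thesis
    unfolding f_gamma_def Let_def
    using assms(1,2)
    by (intro is_form_add is_form_sum is_form_power[where k = "2 * d" and l = "2 * (2 * d)"] is_form_diff
        is_form_homog Y sY s is_form_power[where k = 2 and l = "2 * d"] sq) auto
qed

lemma peval_f_gamma:
  "peval (f_gamma n m d R eta \<beta> p g \<gamma>) v =
    (\<gamma> * v (n+m+2) ^ (2*d) - peval (homog (n+m+2) (2*d) p) v - (v n)\<^sup>2 * v (n+m+2) ^ (2*d-2))\<^sup>2
    + (\<Sum>i<m. (peval (homog (n+m+2) (2*d) (g i)) v - (v (n+i+1))\<^sup>2 * v (n+m+2) ^ (2*d-2))\<^sup>2)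
    + ((R + (\<Sum>i<m. eta i) + \<beta> + \<gamma>) ^ d * v (n+m+2) ^ (2*d)
        - ((\<Sum>i<n. (v i)\<^sup>2) + (\<Sum>j\<le>m. (v (n+j))\<^sup>2)) ^ d - v (n+m+1) ^ (2*d))\<^sup>2"
  by (simp add: f_gamma_def Let_def)

text \<open>With \<open>y = 1\<close>, square roots of \<open>\<gamma> - p(x)\<close> and of the
  \<open>g_i(x)\<close> annihilate all brackets but the last. There the bounds give
  \<open>T \<le> K\<close>, which leaves room for the last slack variable as a root of
  \<open>K ^ d - T ^ d\<close>.\<close>

lemma f_gamma_zero:
  assumes "vars_in n p" "\<forall>i<m. vars_in n (g i)" "d \<ge> 1" and x: "x \<in> feas n m g" "peval p x \<le> \<gamma>"
    and bd: "(\<Sum>i<n. (x i)\<^sup>2) \<le> R" "\<forall>i<m. peval (g i) x \<le> eta i" "- peval p x \<le> \<beta>"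
  obtains v where "v (n+m+2) = 1" "peval (f_gamma n m d R eta \<beta> p g \<gamma>) v = 0"
proof
  define K where "K = R + (\<Sum>i<m. eta i) + \<beta> + \<gamma>"
  define T where "T = (\<Sum>i<n. (x i)\<^sup>2) + ((\<gamma> - peval p x) + (\<Sum>i<m. peval (g i) x))"
  \<comment> \<open>Constraint \<open>g i\<close> belongs to the slack at index
    \<open>n + i + 1\<close>, hence the index \<open>i - n - 1\<close>.\<close>
  define v where "v i = (if i < n then x i else if i = n then sqrt (\<gamma> - peval p x)
    else if i \<le> n + m then sqrt (peval (g (i - n - 1)) x)
    else if i = n + m + 1 then root (2 * d) (K ^ d - T ^ d) else 1)" for i
  have g0: "peval (g i) x \<ge> 0" if "i < m" for i using x(1) that by (auto simp: feas_def)
  show y: "v (n+m+2) = 1" by (simp add: v_def)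
  have cong: "peval q v = peval q x" if "vars_in n q" for q
    using that by (rule peval_cong) (simp add: v_def)
  have hom: "peval (homog (n+m+2) (2*d) q) v = peval q x" if "vars_in n q" for q
    using peval_homog_one[of v "n+m+2", OF y] cong[OF that] by simp
  have homg: "peval (homog (n+m+2) (2*d) (g i)) v = peval (g i) x" if "i < m" for i
    using hom assms(2) that by blast
  have vn: "(v n)\<^sup>2 = \<gamma> - peval p x" using x(2) by (simp add: v_def)
  have vg: "(v (n+i+1))\<^sup>2 = peval (g i) x" if "i < m" for i using that g0 by (simp add: v_def)
  have T: "(\<Sum>i<n. (v i)\<^sup>2) + (\<Sum>j\<le>m. (v (n+j))\<^sup>2) = T"
    unfolding T_def sum.atMost_shift using vn vg by (simp add: v_def)
  have "T \<ge> 0" unfolding T_def using x(2) g0 by (intro add_nonneg_nonneg sum_nonneg) auto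
  moreover have "T \<le> K" unfolding T_def K_def
    using bd sum_mono[of "{..<m}" "\<lambda>i. peval (g i) x" eta] by auto
  ultimately have "T ^ d \<le> K ^ d" by (intro power_mono)
  then have "v (n+m+1) ^ (2*d) = K ^ d - T ^ d" using assms(3) by (simp add: v_def)
  then show "peval (f_gamma n m d R eta \<beta> p g \<gamma>) v = 0"
    unfolding peval_f_gamma T y
    using vn vg homg hom[OF assms(1)] by (simp add: K_def)
qed

lemma pos_def_f_gamma:
  assumes "vars_in n p" "\<forall>i<m. vars_in n (g i)" "d \<ge> 1"
    "deg_le (2 * d) p" "\<forall>i<m. deg_le (2 * d) (g i)"
    and infeasible: "\<And>x. x \<in> feas n m g \<Longrightarrow> \<gamma> < peval p x"
  shows "pos_def (n + m + 3) (f_gamma n m d R eta \<beta> p g \<gamma>)" (is "pos_def _ ?f")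
  unfolding pos_def_def
proof (intro allI impI)
  fix v :: "nat \<Rightarrow> real" assume nz: "\<exists>i<n + m + 3. v i \<noteq> 0"
  define b1 where "b1 v = (\<gamma> * v (n+m+2) ^ (2*d) - peval (homog (n+m+2) (2*d) p) v - (v n)\<^sup>2 * v (n+m+2) ^ (2*d-2))\<^sup>2" for v
  define b2 where "b2 v i = (peval (homog (n+m+2) (2*d) (g i)) v - (v (n+i+1))\<^sup>2 * v (n+m+2) ^ (2*d-2))\<^sup>2" for v i
  define T where "T v = (\<Sum>i<n. (v i)\<^sup>2) + (\<Sum>j\<le>m. (v (n+j))\<^sup>2)" for v :: "nat \<Rightarrow> real"
  define b3 where "b3 v = ((R + (\<Sum>i<m. eta i) + \<beta> + \<gamma>) ^ d * v (n+m+2) ^ (2*d)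
        - T v ^ d - v (n+m+1) ^ (2*d))\<^sup>2" for v
  have f: "peval ?f v = b1 v + (\<Sum>i<m. b2 v i) + b3 v" for v
    unfolding peval_f_gamma b1_def b2_def b3_def T_def ..
  have b: "b1 v \<ge> 0" "b2 v i \<ge> 0" "b3 v \<ge> 0" for v i by (auto simp: b1_def b2_def b3_def)
  have s: "(\<Sum>i<m. b2 v i) \<ge> 0" for v using b by (intro sum_nonneg)
  \<comment> \<open>A vanishing sum of squares makes every bracket vanish.\<close>
  have zero: "b1 v = 0 \<and> (\<forall>i<m. b2 v i = 0) \<and> b3 v = 0" if "peval ?f v = 0" for v
  proof -
    have "b1 v = 0" "(\<Sum>i<m. b2 v i) = 0" "b3 v = 0" using that b[of v] s[of v] unfolding f by linarith+
    then show ?thesis using b by (auto simp: sum_nonneg_eq_0_iff)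
  qed
  have "peval ?f v \<noteq> 0"
  proof
    assume f0: "peval ?f v = 0"
    show False
    proof (cases "v (n+m+2) = 0")
      case True
      have T0: "T v \<ge> 0" unfolding T_def by (intro add_nonneg_nonneg sum_nonneg) auto
      \<comment> \<open>At \<open>y = 0\<close> the last bracket consists of two nonnegative terms
        of equal sign, so both vanish, and with them all coordinates.\<close>
      have "T v ^ d + v (n+m+1) ^ (2*d) = 0"
      proof -
        have 0: "(0::real) ^ (2*d) = 0" using assms(3) by simp
        show ?thesis using zero[OF f0] unfolding b3_def True 0 by simp
      qed
      moreover have "T v ^ d \<ge> 0" "v (n+m+1) ^ (2*d) \<ge> 0" using T0 by (auto simp: power_mult)
      ultimately have "T v ^ d = 0" "v (n+m+1) ^ (2*d) = 0" by linarith+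
      then have "T v = 0" and s: "v (n+m+1) = 0" using assms(3) by auto
      then have "(\<Sum>i<n. (v i)\<^sup>2) = 0" "(\<Sum>j\<le>m. (v (n+j))\<^sup>2) = 0"
        using sum_nonneg[of "{..<n}" "\<lambda>i. (v i)\<^sup>2"] sum_nonneg[of "{..m}" "\<lambda>j. (v (n+j))\<^sup>2"]
        unfolding T_def by simp_all
      then have x: "\<forall>i<n. v i = 0" and s': "\<forall>j\<le>m. v (n+j) = 0"
        by (auto simp: sum_nonneg_eq_0_iff)
      have "v i = 0" if "i < n + m + 3" for i
      proof -
        consider "i < n" | "n \<le> i" "i - n \<le> m" | "i = n+m+1" | "i = n+m+2"
          using \<open>i < n + m + 3\<close> by linarith
        then show ?thesis
        proof cases
          case 2
          then show ?thesis using s' by (metis le_add_diff_inverse)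
        qed (use x s True in auto)
      qed
      then show False using nz by blast
    next
      case False
      define y where "y = v (n+m+2)"
      define w where "w i = v i / y" for i
      have y: "y \<noteq> 0" "w (n+m+2) = 1" using False by (auto simp: y_def w_def)
      have vw: "v = (\<lambda>i. y * w i)" using y by (auto simp: w_def)
      \<comment> \<open>By homogeneity the zero can be rescaled to \<open>y = 1\<close>.\<close>
      have "peval ?f w = 0"
        using f0 y(1) peval_form_scale[OF is_form_f_gamma[OF assms(4,5,3)], of n R eta \<beta> \<gamma> y w]
        unfolding vw[symmetric] by auto
      then have z: "peval p w = \<gamma> - (w n)\<^sup>2" "\<And>i. i < m \<Longrightarrow> peval (g i) w = (w (n+i+1))\<^sup>2"
        using zero[of w] peval_homog_one[of w "n+m+2", OF y(2)] unfolding b1_def b2_def y(2) by auto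
      \<comment> \<open>Elements of \<open>feas\<close> vanish from index \<open>n\<close> on, so
        the slack coordinates are cut off.\<close>
      define x where "x i = (if i < n then w i else 0)" for i
      have cong: "peval q w = peval q x" if "vars_in n q" for q
        using that by (rule peval_cong) (simp add: x_def)
      have "peval (g i) x \<ge> 0" if "i < m" for i
        using z(2)[OF that] cong[of "g i"] assms(2) that by simp
      then have "x \<in> feas n m g" by (auto simp: feas_def x_def)
      then have "\<gamma> < peval p w" using infeasible cong[OF assms(1)] by simp
      then show False unfolding z(1) by (auto simp: not_less)
    qed
  qed
  moreover have "peval ?f v \<ge> 0" using b[of v] s[of v] unfolding f by linarith
  ultimately show "peval ?f v > 0" by linarith
qed

section \<open>Artin cones under perturbation and change of level\<close>

lemma artin_cone_add_sos:
  assumes q: "q \<in> artin_cone N D r" and s: "is_form (2 * D) s" "sos_in N s" and "r \<le> r'" "N > 0"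
  shows "q + s \<in> artin_cone N D r'"
proof -
  obtain h where h: "h \<noteq> 0" "is_form (2 * r) h" "sos_in N h" "sos_in N (q * h)"
    using q by (auto simp: artin_cone_def)
  \<comment> \<open>A nonzero square of degree \<open>2 * (r' - r)\<close>, which lifts the
    denominator \<open>h\<close> to level \<open>r'\<close>.\<close>
  define z :: mpoly where "z = PVar 0 ^ (r' - r) * PVar 0 ^ (r' - r)"
  have "PVar 0 \<noteq> 0" using peval_PVar[of 0 "\<lambda>_. 1"] by (metis peval_zero zero_neq_one)
  then have "h * z \<noteq> 0" using h(1) by (simp add: z_def)
  moreover have "sos_in N z" unfolding z_def using \<open>N > 0\<close> by (intro sos_in_square vars_in_power) simp
  moreover have "is_form (2 * (r' - r)) z"
    unfolding z_def by (rule is_form_mult[OF is_form_power[OF is_form_PVar refl] is_form_power[OF is_form_PVar refl]]) simp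
  then have "is_form (2 * r') (h * z)" by (rule is_form_mult[OF h(2)]) (use \<open>r \<le> r'\<close> in simp)
  moreover have "sos_in N ((q + s) * (h * z))"
  proof -
    have "(q + s) * (h * z) = (q * h) * z + s * (h * z)" by (simp add: algebra_simps)
    then show ?thesis using h s \<open>sos_in N z\<close> by auto
  qed
  ultimately show ?thesis
    using q s h \<open>sos_in N z\<close> vars_in_sos[of N] unfolding artin_cone_def by blast
qed

lemma artin_cone_nonneg: "q \<in> artin_cone N D r \<Longrightarrow> peval q v \<ge> 0"
  unfolding artin_cone_def using peval_nonneg_of_mult sos_in_nonneg by blast

definition norm2 :: "nat \<Rightarrow> mpoly" where
  "norm2 N = (\<Sum>i<N. PVar i ^ 2)"

lemma peval_norm2 [simp]: "peval (norm2 N) v = (\<Sum>i<N. (v i)\<^sup>2)"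
  by (simp add: norm2_def)

lemma norm2_power_sos:
  assumes "c \<ge> 0"
  shows "is_form (2 * D) (PConst c * norm2 N ^ D)" "sos_in N (PConst c * norm2 N ^ D)"
proof -
  have "is_form 2 (norm2 N)" unfolding norm2_def
    by (intro is_form_sum is_form_power[OF is_form_PVar]) simp
  from is_form_power[OF this refl, of D] show "is_form (2 * D) (PConst c * norm2 N ^ D)"
    by (rule is_form_mult[OF is_form_PConst]) simp
  have "sos_in N (norm2 N)" unfolding norm2_def power2_eq_square
    by (intro sos_in_sum sos_in_square) simp
  then show "sos_in N (PConst c * norm2 N ^ D)" using sos_in_const[OF assms] by blast
qed

lemma PConst_diff: "PConst a - PConst b = PConst (a - b)"
  by (simp add: PConst_def single_diff)

text \<open>Weakening the perturbation adds a nonnegative multiple of \<open>norm2 N ^ D\<close>, a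
  sum of squares.\<close>

lemma artin_cone_perturb_mono:
  assumes "F - PConst a * norm2 N ^ D \<in> artin_cone N D r" "b \<le> a" "r \<le> r'" "N > 0"
  shows "F - PConst b * norm2 N ^ D \<in> artin_cone N D r'"
proof -
  have "F - PConst b * norm2 N ^ D = (F - PConst a * norm2 N ^ D) + PConst (a - b) * norm2 N ^ D"
    by (simp add: PConst_diff[symmetric] algebra_simps)
  moreover have "a - b \<ge> 0" using assms(2) by simp
  ultimately show ?thesis
    using artin_cone_add_sos[OF assms(1) norm2_power_sos assms(3,4)] by metis
qed

text \<open>The perturbation \<open>1 / r\<close> and the level \<open>r\<close> are tied together,
  so Habicht's theorem is applied once, to a fixed perturbation \<open>1 / k\<close>, at some level
  \<open>r1\<close>. For \<open>r\<close> beyond both \<open>k\<close> and \<open>r1\<close>, the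
  perturbation only weakens and the level only rises.\<close>

lemma artin_cone_pos_def:
  assumes "pos_def N f" "vars_in N f" "is_form (2 * D) f" "N > 0"
  obtains r0 where "\<And>r. r \<ge> r0 \<Longrightarrow> f - PConst (1 / real r) * norm2 N ^ D \<in> artin_cone N D r"
proof -
  obtain e where e: "e > 0" "\<And>v. \<exists>i<N. v i \<noteq> 0 \<Longrightarrow> peval f v \<ge> e * (\<Sum>i<N. (v i)\<^sup>2) ^ D"
    using pos_def_form_bound[OF assms(1,2,4,3)] by blast
  obtain k where k: "k > 0" "1 / real k < e"
    using reals_Archimedean[OF e(1)] by (metis inverse_eq_divide zero_less_Suc)
  define F where "F = f - PConst (1 / real k) * norm2 N ^ D"
  have "pos_def N F" unfolding pos_def_def
  proof (intro allI impI)
    fix v :: "nat \<Rightarrow> real" assume v: "\<exists>i<N. v i \<noteq> 0"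
    then have "(\<Sum>i<N. (v i)\<^sup>2) > 0" by (auto intro: sum_pos2)
    then have "1 / real k * (\<Sum>i<N. (v i)\<^sup>2) ^ D < e * (\<Sum>i<N. (v i)\<^sup>2) ^ D"
      using k(2) by (intro mult_strict_right_mono) auto
    also have "\<dots> \<le> peval f v" using e(2) v by blast
    finally show "peval F v > 0" by (simp add: F_def)
  qed
  moreover have F: "vars_in N F" "is_form (2 * D) F"
    unfolding F_def using assms norm2_power_sos[of "1 / real k"] vars_in_sos by auto
  ultimately obtain h r1 where "h \<noteq> 0" "is_form (2 * r1) h" "sos_in N h" "sos_in N (F * h)"
    using habicht \<open>N > 0\<close> by blast
  then have "F \<in> artin_cone N D r1"
    using F vars_in_sos unfolding artin_cone_def by blast
  then have "f - PConst (1 / real r) * norm2 N ^ D \<in> artin_cone N D r" if "r \<ge> max r1 k" for r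
    using that k(1) \<open>N > 0\<close> unfolding F_def
    by (elim artin_cone_perturb_mono) (auto simp: frac_le)
  then show thesis by (rule that)
qed

section \<open>Upper bound, monotonicity and limit of the sequence \<open>l_r\<close>\<close>

theorem theorem3p2:
  fixes n m d :: nat and R \<beta> :: real and eta :: "nat \<Rightarrow> real"
    and p :: mpoly and g :: "nat \<Rightarrow> mpoly"
  assumes vars_p: "vars_in n p" and vars_g: "\<forall>i<m. vars_in n (g i)"
    and d_pos: "d \<ge> 1"
    and deg_p: "deg_le (2*d) p" and deg_g: "\<forall>i<m. deg_le (2*d) (g i)"
    and d_min: "d = 1 \<or> \<not> (deg_le (2*d-2) p \<and> (\<forall>i<m. deg_le (2*d-2) (g i)))"
    and R_pos: "R > 0"
    and ball: "\<forall>x\<in>feas n m g. (\<Sum>i<n. (x i)^2) \<le> R"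
    and eta_bd: "\<forall>i<m. \<forall>x\<in>feas n m g. peval (g i) x \<le> eta i"
    and beta_bd: "\<forall>x\<in>feas n m g. - peval p x \<le> \<beta>"
  shows "(\<forall>r\<ge>1. l_seq n m d R eta \<beta> p g r \<le> pstar n m p g)
    \<and> (\<forall>r\<ge>1. l_seq n m d R eta \<beta> p g r \<le> l_seq n m d R eta \<beta> p g (Suc r))
    \<and> (l_seq n m d R eta \<beta> p g \<longlonglongrightarrow> pstar n m p g)"
proof -
  define N where "N = n + m + 3"
  define f where "f = f_gamma n m d R eta \<beta> p g"
  define feasible where "feasible \<gamma> r \<longleftrightarrow> f \<gamma> - PConst (1 / real r) * norm2 N ^ (2 * d) \<in> artin_cone N (2 * d) r" for \<gamma> r
  let ?l = "l_seq n m d R eta \<beta> p g" and ?p = "pstar n m p g"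
  have l: "?l r = Sup {ereal \<gamma> | \<gamma>. feasible \<gamma> r}" for r
    by (simp add: l_seq_def Let_def feasible_def f_def norm2_def N_def)
  have "N > 0" by (simp add: N_def)
  have upper: "?l r \<le> ?p" if "r \<ge> 1" for r
    unfolding l
  proof (intro Sup_least, clarify, rule ccontr)
    fix \<gamma> assume feas: "feasible \<gamma> r" and "\<not> ereal \<gamma> \<le> ?p"
    then obtain x where x: "x \<in> feas n m g" "peval p x < \<gamma>"
      unfolding pstar_def not_le INF_less_iff by auto
    obtain v where v: "v (n+m+2) = 1" "peval (f \<gamma>) v = 0"
      unfolding f_def
      using f_gamma_zero[OF vars_p vars_g d_pos x(1) less_imp_le[OF x(2)], of R eta \<beta>]
        x(1) ball eta_bd beta_bd by blast
    have "(\<Sum>i<N. (v i)\<^sup>2) > 0" using v(1) by (intro sum_pos2[of _ "n+m+2"]) (auto simp: N_def)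
    then have "1 / real r * (\<Sum>i<N. (v i)\<^sup>2) ^ (2 * d) > 0" using that by simp
    \<comment> \<open>The perturbed form equals minus the positive perturbation at the zero
      \<open>v\<close>, contradicting nonnegativity on the cone.\<close>
    moreover have "peval (f \<gamma> - PConst (1 / real r) * norm2 N ^ (2 * d)) v \<ge> 0"
      using feas unfolding feasible_def by (rule artin_cone_nonneg)
    ultimately show False using v(2) by simp
  qed
  moreover have "?l r \<le> ?l (Suc r)" if "r \<ge> 1" for r
  proof -
    \<comment> \<open>\<open>1 / Suc r \<le> 1 / r\<close>, so passing to \<open>Suc r\<close>
      weakens the perturbation while raising the level.\<close>
    have "feasible \<gamma> (Suc r)" if "feasible \<gamma> r" for \<gamma>
      using that \<open>r \<ge> 1\<close> \<open>N > 0\<close> unfolding feasible_def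
      by (elim artin_cone_perturb_mono) (auto simp: frac_le)
    then show ?thesis unfolding l by (intro Sup_subset_mono) auto
  qed
  moreover have "?l \<longlonglongrightarrow> ?p"
  proof (rule order_tendstoI)
    fix a assume "a < ?p"
    \<comment> \<open>A real \<open>\<gamma>\<close> in between exists even if the infimum is
      infinite.\<close>
    then obtain \<gamma> where \<gamma>: "a < ereal \<gamma>" "ereal \<gamma> < ?p" using ereal_dense2 by blast
    have "\<gamma> < peval p x" if "x \<in> feas n m g" for x
    proof -
      have "?p \<le> ereal (peval p x)" unfolding pstar_def using that by (rule INF_lower)
      then show ?thesis using \<gamma>(2) by (metis less_le_trans less_ereal.simps(1))
    qed
    then have "pos_def N (f \<gamma>)"
      unfolding f_def N_def by (rule pos_def_f_gamma[OF vars_p vars_g d_pos deg_p deg_g])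
    moreover have "vars_in N (f \<gamma>)" "is_form (2 * (2 * d)) (f \<gamma>)"
      unfolding f_def N_def using vars_in_f_gamma is_form_f_gamma vars_p vars_g deg_p deg_g d_pos by auto
    ultimately obtain r0 where "\<And>r. r \<ge> r0 \<Longrightarrow> feasible \<gamma> r"
      unfolding feasible_def using artin_cone_pos_def \<open>N > 0\<close> by metis
    then have "ereal \<gamma> \<le> ?l r" if "r \<ge> r0" for r
      unfolding l using that by (intro Sup_upper) auto
    then show "\<forall>\<^sub>F r in sequentially. a < ?l r"
      unfolding eventually_sequentially using \<gamma>(1) less_le_trans by blast
  next
    fix a assume "?p < a"
    then show "\<forall>\<^sub>F r in sequentially. ?l r < a"
      unfolding eventually_sequentially using upper le_less_trans by blast
  qed
  ultimately show ?thesis by blast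
qed

end
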